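(* Let $n\ge1$, let $H\in\mathbb{R}^{n\times n}$ be symmetric and let $c\in\mathbb{R}^n$. Set $$A=\begin{bmatrix}H&0\\0&H\end{bmatrix}\in\mathbb{R}^{2n\times 2n},\qquad a=\begin{bmatrix}c\\0\end{bmatrix}\in\mathbb{R}^{2n},\qquad f(z)=\tfrac12z^TAz+a^Tz,$$ let $\partial B_{2n}=\{z\in\mathbb{R}^{2n}: z^Tz=1\}$, and let $L=\|H\|_2$ be the spectral norm. Let $\eta_e\in(0,1/L]$ be a constant step size and let $z^0$ be uniformly and randomly generated from $\partial B_{2n}$. Then, with probability one, the sequence generated by $$z^{k+1}=\frac{z^k-\eta_e\nabla f(z^k)}{\|z^k-\eta_e\nabla f(z^k)\|},\qquad k=0,1,2,\dots,$$ converges to a global minimizer of $\min\{f(z): z\in\partial B_{2n}\}$.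
   Context: $\nabla f(z)=Az+a$, and $\|\cdot\|$ is the Euclidean norm. Convention: if $z^k-\eta_e\nabla f(z^k)=0$ for some $k$, the iteration stops at $z^k$, and the sequence is regarded as converging to $z^k$ (i.e. constant from then on). "Uniformly" refers to the normalized surface measure on the sphere $\partial B_{2n}$. *)

theory Defs
  imports "HOL-Probability.Probability"
begin

section \<open>The quadratic program on the unit sphere\<close>

text \<open>
  The index type of \<open>\<real>\<^sup>2\<^sup>n\<close> is the disjoint sum \<^typ>\<open>'n + 'n\<close>: the indices \<open>Inl i\<close> address the first
  block of \<open>n\<close> coordinates and the indices \<open>Inr i\<close> the second one.
\<close>

definition block_diag2 :: "real ^ 'n ^ 'n \<Rightarrow> real ^ ('n + 'n) ^ ('n + 'n)" where
  "block_diag2 H = (\<chi> i j. case (i, j) of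
      (Inl p, Inl q) \<Rightarrow> H $ p $ q
    | (Inr p, Inr q) \<Rightarrow> H $ p $ q
    | _ \<Rightarrow> 0)"

definition pad_zero :: "real ^ 'n \<Rightarrow> real ^ ('n + 'n)" where
  "pad_zero c = (\<chi> i. case i of Inl p \<Rightarrow> c $ p | Inr _ \<Rightarrow> 0)"

definition quad :: "real ^ 'm ^ 'm \<Rightarrow> real ^ 'm \<Rightarrow> real ^ 'm \<Rightarrow> real" where
  "quad A a z = (1 / 2) * (z \<bullet> (A *v z)) + a \<bullet> z"

definition grad_quad :: "real ^ 'm ^ 'm \<Rightarrow> real ^ 'm \<Rightarrow> real ^ 'm \<Rightarrow> real ^ 'm" where
  "grad_quad A a z = A *v z + a"

lemma has_derivative_quad:
  fixes A :: "real ^ 'm ^ 'm"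
  assumes "transpose A = A"
  shows "(quad A a has_derivative (\<lambda>h. grad_quad A a z \<bullet> h)) (at z)"
proof -
  have bl: "bounded_linear ((*v) A)" by (rule matrix_vector_mul_bounded_linear)
  have sym: "z \<bullet> (A *v h) = (A *v z) \<bullet> h" for h
    using assms dot_lmul_matrix[of z A h] by (metis vector_transpose_matrix)
  have "((\<lambda>z. (1 / 2) * (z \<bullet> (A *v z)) + a \<bullet> z) has_derivative
        (\<lambda>h. (1 / 2) * (z \<bullet> (A *v h) + h \<bullet> (A *v z)) + a \<bullet> h)) (at z)"
    by (auto intro!: derivative_eq_intros bounded_linear.has_derivative[OF bl])
  also have "(\<lambda>h. (1 / 2) * (z \<bullet> (A *v h) + h \<bullet> (A *v z)) + a \<bullet> h) = (\<lambda>h. grad_quad A a z \<bullet> h)"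
    by (auto simp: grad_quad_def sym inner_add_left inner_add_right inner_commute)
  finally show ?thesis unfolding quad_def [abs_def] .
qed

text \<open>
  If \<open>z - \<eta> \<nabla>f(z) = 0\<close> then the iteration stops at \<open>z\<close>. This is encoded by making \<open>z\<close> a fixed point of
  the step, so that the sequence of iterates is constant from then on.
\<close>

definition pg_step :: "real ^ 'm ^ 'm \<Rightarrow> real ^ 'm \<Rightarrow> real \<Rightarrow> real ^ 'm \<Rightarrow> real ^ 'm" where
  "pg_step A a \<eta> z =
     (let w = z - \<eta> *\<^sub>R grad_quad A a z in if w = 0 then z else w /\<^sub>R norm w)"

primrec pg_iter :: "real ^ 'm ^ 'm \<Rightarrow> real ^ 'm \<Rightarrow> real \<Rightarrow> real ^ 'm \<Rightarrow> nat \<Rightarrow> real ^ 'm" where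
  "pg_iter A a \<eta> z0 0 = z0"
| "pg_iter A a \<eta> z0 (Suc k) = pg_step A a \<eta> (pg_iter A a \<eta> z0 k)"


section \<open>Surface measure on the unit sphere\<close>

text \<open>
  The surface measure from integration in polar coordinates: with \<open>d\<close> the dimension and \<open>\<lambda>\<close> Lebesgue
  measure, \<open>\<sigma>(E) = d \<cdot> \<lambda> {r\<theta> | 0 < r \<le> 1, \<theta> \<in> E}\<close> for Borel subsets \<open>E\<close> of the unit sphere. It is the
  image of \<open>d \<cdot> \<lambda>\<close> on the punctured unit ball under the radial projection \<open>sgn x = x / norm x\<close>.
\<close>

definition sphere_surface_measure :: "'a::euclidean_space measure" where
  "sphere_surface_measure = scale_measure (ennreal DIM('a))
     (distr (restrict_space lborel (cball 0 1 - {0})) (restrict_space borel (sphere 0 1)) sgn)"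

definition uniform_sphere :: "'a::euclidean_space measure" where
  "uniform_sphere = uniform_measure sphere_surface_measure (sphere 0 1)"

lemma space_sphere_surface_measure [simp]:
  "space (sphere_surface_measure :: 'a::euclidean_space measure) = sphere 0 1"
  by (simp add: sphere_surface_measure_def space_restrict_space space_scale_measure)

lemma sets_sphere_surface_measure [simp, measurable_cong]:
  "sets (sphere_surface_measure :: 'a::euclidean_space measure) = sets (restrict_space borel (sphere 0 1))"
  by (simp add: sphere_surface_measure_def)

lemma emeasure_sphere_surface_measure:
  fixes E :: "'a::euclidean_space set"
  assumes "E \<in> sets borel" "E \<subseteq> sphere 0 1"
  shows "emeasure sphere_surface_measure E =
           ennreal DIM('a) * emeasure lborel {r *\<^sub>R x |r x. 0 < r \<and> r \<le> 1 \<and> x \<in> E}"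
proof -
  let ?B = "cball 0 1 - {0::'a}"
  let ?R = "restrict_space lborel ?B" and ?S = "restrict_space borel (sphere (0::'a) 1)"
  have meas: "sgn \<in> ?R \<rightarrow>\<^sub>M ?S"
    by (intro measurable_restrict_space2 measurable_restrict_space1)
       (auto simp: space_restrict_space norm_sgn)
  have E: "E \<in> sets ?S"
    using assms by (simp add: sets_restrict_space_iff)
  have eq: "sgn -` E \<inter> ?B = {r *\<^sub>R x |r x. 0 < r \<and> r \<le> 1 \<and> x \<in> E}"
  proof (intro equalityI subsetI)
    fix y assume y: "y \<in> sgn -` E \<inter> ?B"
    then have "y = norm y *\<^sub>R sgn y" "0 < norm y" "norm y \<le> 1" "sgn y \<in> E"
      by (auto simp: sgn_div_norm)
    then show "y \<in> {r *\<^sub>R x |r x. 0 < r \<and> r \<le> 1 \<and> x \<in> E}" by blast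
  next
    fix y assume "y \<in> {r *\<^sub>R x |r x. 0 < r \<and> r \<le> 1 \<and> x \<in> E}"
    then obtain r x where y: "y = r *\<^sub>R x" "0 < r" "r \<le> 1" "x \<in> E" by blast
    moreover have "norm x = 1" using y assms by auto
    ultimately show "y \<in> sgn -` E \<inter> ?B" by (auto simp: sgn_div_norm)
  qed
  have "emeasure (distr ?R ?S sgn) E = emeasure ?R (sgn -` E \<inter> ?B)"
    using meas E by (simp add: emeasure_distr space_restrict_space)
  also have "\<dots> = emeasure lborel (sgn -` E \<inter> ?B)"
    by (subst emeasure_restrict_space) auto
  finally show ?thesis
    by (simp add: sphere_surface_measure_def eq)
qed

lemma emeasure_sphere_surface_measure_sphere:
  "emeasure sphere_surface_measure (sphere (0::'a::euclidean_space) 1) \<noteq> 0"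
  "emeasure sphere_surface_measure (sphere (0::'a::euclidean_space) 1) \<noteq> \<infinity>"
proof -
  let ?C = "{r *\<^sub>R x |r x. 0 < r \<and> r \<le> 1 \<and> x \<in> sphere (0::'a) 1}"
  have C: "?C = cball 0 1 - {0}"
  proof (intro equalityI subsetI)
    fix y :: 'a assume "y \<in> cball 0 1 - {0}"
    then have "y = norm y *\<^sub>R sgn y" "0 < norm y" "norm y \<le> 1" "sgn y \<in> sphere 0 1"
      by (auto simp: sgn_div_norm)
    then show "y \<in> ?C" by blast
  qed auto
  have "emeasure lborel (cball 0 1 - {0::'a}) = emeasure lborel (cball 0 (1::real) :: 'a set)"
    by (subst emeasure_Diff) auto
  moreover have "emeasure lborel (cball 0 (1::real) :: 'a set) \<noteq> \<infinity>"
    using emeasure_bounded_finite[of "cball 0 (1::real) :: 'a set"] by auto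
  moreover have "emeasure lborel (cball 0 (1::real) :: 'a set) \<noteq> 0"
    by (simp add: emeasure_cball ennreal_eq_0_iff unit_ball_vol_def Gamma_real_pos not_le
                  divide_pos_pos add_pos_nonneg)
  ultimately show
    "emeasure sphere_surface_measure (sphere (0::'a) 1) \<noteq> 0"
    "emeasure sphere_surface_measure (sphere (0::'a) 1) \<noteq> \<infinity>"
    by (auto simp: emeasure_sphere_surface_measure C[simplified] ennreal_mult_eq_top_iff)
qed

lemma space_uniform_sphere [simp]: "space (uniform_sphere :: 'a::euclidean_space measure) = sphere 0 1"
  by (simp add: uniform_sphere_def)

lemma prob_space_uniform_sphere: "prob_space (uniform_sphere :: 'a::euclidean_space measure)"
  unfolding uniform_sphere_def
  by (rule prob_space_uniform_measure) (fact emeasure_sphere_surface_measure_sphere)+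

end

theory Submission
  imports Defs
begin

text \<open>
  On the sphere, minimising \<open>f\<close> is maximising the convex quadratic
  \<open>g(z) = \<langle>z, Wz\<rangle>/2 + \<langle>b, z\<rangle>\<close> with \<open>W = I - \<eta>A \<ge> 0\<close> and \<open>b = - \<eta>a\<close>, and a step is
  \<open>s\<^sub>k z\<^sub>k\<^sub>+\<^sub>1 = W z\<^sub>k + b\<close> with \<open>s\<^sub>k = \<parallel>W z\<^sub>k + b\<parallel>\<close> (this also holds when the iteration stops).
  Convexity makes \<open>g\<close> increase by at least \<open>s\<^sub>k \<parallel>z\<^sub>k\<^sub>+\<^sub>1 - z\<^sub>k\<parallel>\<^sup>2 / 2\<close>, so every cluster point \<open>x\<close>
  satisfies \<open>W x + b = s x\<close> with \<open>s = \<parallel>W x + b\<parallel>\<close>; it is a global maximiser as soon as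
  \<open>s \<ge> \<omega>\<close>, the largest eigenvalue of \<open>W\<close>.

  Doubling the dimension supplies an eigenvector \<open>v = (0, u)\<close> for \<open>\<omega>\<close> that is orthogonal to \<open>b\<close>,
  hence \<open>s\<^sub>k \<langle>v, z\<^sub>k\<^sub>+\<^sub>1\<rangle> = \<omega> \<langle>v, z\<^sub>k\<rangle>\<close>. Unless \<open>\<langle>v, z\<^sub>0\<rangle> = 0\<close>, which is a null event, boundedness
  of \<open>\<langle>v, z\<^sub>k\<rangle>\<close> prevents \<open>s\<^sub>k\<close> from staying below \<open>\<omega>\<close>. So some cluster point is a global maximiser,
  and then all are, by monotonicity of \<open>g(z\<^sub>k)\<close>.

  If \<open>x \<noteq> y\<close> were two cluster points, then \<open>d = y - x\<close> would be an eigenvector for \<open>\<omega>\<close> orthogonal to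
  \<open>b\<close>, so that \<open>\<langle>d, z\<^sub>k\<rangle>\<close> could not change sign; but \<open>\<langle>d, y\<rangle> = \<parallel>d\<parallel>\<^sup>2/2 = - \<langle>d, x\<rangle>\<close>.
\<close>

section \<open>Semidefinite forms and cluster points\<close>

text \<open>If \<open>q = Q d\<close> were nonzero, a short move from \<open>d\<close> along
  \<open>- q\<close> would make the form negative, its linear term outweighing the quadratic
  one.\<close>

lemma psd_form_eq_0_imp_kernel:
  fixes Q :: "'a::real_inner \<Rightarrow> 'a"
  assumes lin: "linear Q" and sym: "\<And>x y. x \<bullet> Q y = Q x \<bullet> y"
    and psd: "\<And>x. 0 \<le> x \<bullet> Q x" and zero: "d \<bullet> Q d = 0"
  shows "Q d = 0"
proof (rule ccontr)
  assume "Q d \<noteq> 0"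
  define q where "q = Q d"
  define n where "n = q \<bullet> q"
  define m where "m = q \<bullet> Q q"
  \<comment> \<open>Any positive \<open>t\<close> with \<open>t * m < 2 * n\<close> works; the
    \<open>+ 1\<close> covers \<open>m = 0\<close>.\<close>
  define t where "t = n / (m + 1)"
  have n: "n > 0" using \<open>Q d \<noteq> 0\<close> by (simp add: n_def q_def)
  have m: "m \<ge> 0" using psd by (simp add: m_def)
  have t: "t > 0" "t * m < 2 * n"
  proof -
    show "t > 0" using n m by (simp add: t_def)
    have "t * m \<le> t * (m + 1)" using \<open>t > 0\<close> by simp
    also have "\<dots> = n" using m by (simp add: t_def)
    finally show "t * m < 2 * n" using n by simp
  qed
  have "d \<bullet> Q q = n" by (simp add: sym n_def q_def)
  then have "(d - t *\<^sub>R q) \<bullet> Q (d - t *\<^sub>R q) = t * (t * m - 2 * n)"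
    using zero
    by (simp add: linear_diff[OF lin] linear_scale[OF lin] inner_diff_left inner_diff_right
        flip: q_def m_def n_def) (simp add: n_def algebra_simps inner_commute)
  also have "\<dots> < 0" using t by (simp add: mult_pos_neg)
  finally show False using psd[of "d - t *\<^sub>R q"] by simp
qed

text \<open>Otherwise infinitely many terms keep distance at least \<open>e\<close> from
  \<open>l\<close>, and compactness gives them a cluster point other than \<open>l\<close>.\<close>

lemma compact_unique_cluster_imp_tendsto:
  fixes x :: "nat \<Rightarrow> 'a::metric_space"
  assumes S: "compact S" and mem: "\<And>k. x k \<in> S"
    and cluster: "\<And>r y. strict_mono r \<Longrightarrow> (x \<circ> r) \<longlonglongrightarrow> y \<Longrightarrow> y = l"
  shows "x \<longlonglongrightarrow> l"
proof (rule ccontr)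
  assume "\<not> x \<longlonglongrightarrow> l"
  then obtain e where e: "e > 0" "\<exists>\<^sub>F k in sequentially. \<not> dist (x k) l < e"
    by (auto simp: tendsto_iff frequently_def)
  then have "infinite {k. \<not> dist (x k) l < e}"
    by (simp add: frequently_cofinite flip: cofinite_eq_sequentially)
  then obtain r :: "nat \<Rightarrow> nat" where r: "strict_mono r" "\<And>k. \<not> dist (x (r k)) l < e"
    using infinite_enumerate by blast
  obtain y r' where y: "strict_mono r'" "((x \<circ> r) \<circ> r') \<longlonglongrightarrow> y"
    using S mem unfolding compact_def by (metis comp_apply)
  have "y = l" using cluster[of "r \<circ> r'"] y r(1) by (simp add: strict_mono_o o_assoc)
  then have "\<forall>\<^sub>F k in sequentially. dist (x (r (r' k))) l < e"
    using tendstoD[OF y(2) e(1)] by simp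
  then show False using r(2) by (simp add: eventually_sequentially)
qed

section \<open>Deterministic convergence of the normalized affine iteration\<close>

text \<open>\<open>generic\<close> forces \<open>v\<close> to be nonzero, so \<open>\<omega>\<close>
  is an eigenvalue, by \<open>top\<close> the largest. \<open>stop\<close> is separate because
  \<open>step\<close> leaves \<open>z (Suc k)\<close> free when
  \<open>W (z k) + b = 0\<close>.\<close>

locale normalized_affine_iteration =
  fixes W :: "'a::euclidean_space \<Rightarrow> 'a" and b v :: 'a and \<omega> :: real and z :: "nat \<Rightarrow> 'a"
  assumes lin: "linear W"
    and sym: "\<And>x y. x \<bullet> W y = W x \<bullet> y"
    and psd: "\<And>x. 0 \<le> x \<bullet> W x"
    and top: "\<And>x. x \<bullet> W x \<le> \<omega> * (x \<bullet> x)"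
    and eig: "W v = \<omega> *\<^sub>R v"
    and orth: "v \<bullet> b = 0"
    and norm_z: "\<And>k. norm (z k) = 1"
    and step: "\<And>k. norm (W (z k) + b) *\<^sub>R z (Suc k) = W (z k) + b"
    and stop: "\<And>k. W (z k) + b = 0 \<Longrightarrow> z (Suc k) = z k"
    and generic: "v \<bullet> z 0 \<noteq> 0"
begin

definition g :: "'a \<Rightarrow> real" where
  "g x = (x \<bullet> W x) / 2 + b \<bullet> x"

text \<open>Where \<open>W x + b = s x *\<^sub>R x\<close>, this is the Lagrange multiplier of the
  sphere constraint.\<close>

definition s :: "'a \<Rightarrow> real" where
  "s x = norm (W x + b)"

lemma W_tendsto: "(f \<longlongrightarrow> l) F \<Longrightarrow> ((\<lambda>k. W (f k)) \<longlongrightarrow> W l) F"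
  using lin linear_continuous_at[of W l] by (auto simp: linear_linear intro: isCont_tendsto_compose)

lemma s_tendsto: "(f \<longlongrightarrow> l) F \<Longrightarrow> ((\<lambda>k. s (f k)) \<longlongrightarrow> s l) F"
  unfolding s_def by (intro tendsto_intros W_tendsto)

lemma g_tendsto: "(f \<longlongrightarrow> l) F \<Longrightarrow> ((\<lambda>k. g (f k)) \<longlongrightarrow> g l) F"
  unfolding g_def by (intro tendsto_intros W_tendsto) auto

lemma s_nonneg: "0 \<le> s x" by (simp add: s_def)

lemma step': "s (z k) *\<^sub>R z (Suc k) = W (z k) + b"
  using step by (simp add: s_def)

lemma inner_z_self: "z k \<bullet> z k = 1"
  using norm_z[of k] by (simp add: norm_eq_1)

lemma g_expand: "g y = g x + (W x + b) \<bullet> (y - x) + ((y - x) \<bullet> W (y - x)) / 2"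
  using sym[of x y]
  by (simp add: g_def linear_diff[OF lin] inner_diff_left inner_diff_right inner_add_left
      inner_commute algebra_simps) (simp add: field_simps)

lemma inner_diff_unit:
  fixes x y :: 'a
  assumes "norm x = 1" "norm y = 1"
  shows "x \<bullet> (y - x) = - ((y - x) \<bullet> (y - x)) / 2"
  using assms by (simp add: norm_eq_1 inner_diff_left inner_diff_right inner_commute)

lemma g_increase: "s (z k) * (norm (z (Suc k) - z k))\<^sup>2 / 2 \<le> g (z (Suc k)) - g (z k)"
proof -
  have "(W (z k) + b) \<bullet> (z (Suc k) - z k)
      = s (z k) * (norm (z (Suc k) - z k))\<^sup>2 / 2"
    unfolding step'[symmetric]
    by (simp add: power2_norm_eq_inner inner_diff_left inner_diff_right inner_commute
        inner_z_self algebra_simps)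
  then show ?thesis
    using g_expand[of "z (Suc k)" "z k"] psd[of "z (Suc k) - z k"] by simp
qed

lemma g_incseq: "incseq (\<lambda>k. g (z k))"
proof (rule incseq_SucI)
  fix k
  have "0 \<le> s (z k) * (norm (z (Suc k) - z k))\<^sup>2 / 2" by (simp add: s_nonneg)
  then show "g (z k) \<le> g (z (Suc k))" using g_increase[of k] by linarith
qed

lemma subseq_cluster:
  fixes r :: "nat \<Rightarrow> nat"
  assumes "strict_mono r"
  obtains x r' where "strict_mono r'" "norm x = 1" "(z \<circ> (r \<circ> r')) \<longlonglongrightarrow> x"
proof -
  have "compact (sphere (0::'a) 1)" by simp
  moreover have "\<forall>k. (z \<circ> r) k \<in> sphere 0 1" by (simp add: norm_z)
  ultimately obtain x r' where "x \<in> sphere 0 1" "strict_mono r'" "((z \<circ> r) \<circ> r') \<longlonglongrightarrow> x"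
    unfolding compact_def by blast
  then show ?thesis using that by (simp add: o_assoc)
qed

lemma cluster_norm:
  assumes "(z \<circ> r) \<longlonglongrightarrow> x" shows "norm x = 1"
  using tendsto_norm[OF assms] LIMSEQ_unique[OF _ tendsto_const] by (simp add: norm_z)

text \<open>Monotonicity lets one subsequence fix the limit of all \<open>g (z k)\<close>; hence
  \<open>g\<close> agrees at all cluster points.\<close>

lemma g_tendsto_cluster:
  assumes r: "strict_mono r" "(z \<circ> r) \<longlonglongrightarrow> x"
  shows "(\<lambda>k. g (z k)) \<longlonglongrightarrow> g x"
proof -
  have lim: "((\<lambda>k. g (z k)) \<circ> r) \<longlonglongrightarrow> g x"
    using g_tendsto[OF r(2)] by (simp add: o_def)
  have "g (z k) \<le> g x" for k
  proof -
    have "incseq ((\<lambda>k. g (z k)) \<circ> r)"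
      using g_incseq r(1) by (auto simp: incseq_def strict_mono_less_eq)
    then have "g (z (r k)) \<le> g x" using incseq_le[OF _ lim, of k] by simp
    moreover have "g (z k) \<le> g (z (r k))"
      using g_incseq seq_suble[OF r(1), of k] by (simp add: incseq_def)
    ultimately show ?thesis by simp
  qed
  then obtain l where l: "(\<lambda>k. g (z k)) \<longlonglongrightarrow> l"
    using incseq_convergent[OF g_incseq] by metis
  then show ?thesis using LIMSEQ_subseq_LIMSEQ[OF l r(1)] lim LIMSEQ_unique by metis
qed

text \<open>The squared residual is at most \<open>s (z k)\<close> times twice the increase of
  \<open>g\<close>, and the increases vanish. Nothing is divided by \<open>s\<close>, so
  \<open>s x = 0\<close> is covered.\<close>

lemma cluster_stationary:
  assumes r: "strict_mono r" "(z \<circ> r) \<longlonglongrightarrow> x"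
  shows "W x + b = s x *\<^sub>R x"
proof -
  let ?e = "\<lambda>k. W (z k) + b - s (z k) *\<^sub>R z k"
  have bound: "(norm (?e k))\<^sup>2 \<le> s (z k) * (2 * (g (z (Suc k)) - g (z k)))" for k
  proof -
    have "?e k = s (z k) *\<^sub>R (z (Suc k) - z k)" by (simp add: scaleR_diff_right step')
    then have "(norm (?e k))\<^sup>2 = s (z k) * (s (z k) * (norm (z (Suc k) - z k))\<^sup>2)"
      by (simp add: power_mult_distrib power2_eq_square)
    also have "\<dots> \<le> s (z k) * (2 * (g (z (Suc k)) - g (z k)))"
      using g_increase[of k] s_nonneg by (intro mult_left_mono) auto
    finally show ?thesis .
  qed
  have "(\<lambda>k. 2 * (g (z (Suc k)) - g (z k))) \<longlonglongrightarrow> 2 * (g x - g x)"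
    by (intro tendsto_intros g_tendsto_cluster[OF r] LIMSEQ_Suc)
  from LIMSEQ_subseq_LIMSEQ[OF this r(1)] have "(\<lambda>k. s (z (r k)) * (2 * (g (z (Suc (r k))) - g (z (r k))))) \<longlonglongrightarrow> s x * (2 * (g x - g x))"
    using s_tendsto[OF r(2)] unfolding o_def by (rule tendsto_mult[rotated])
  then have lim0: "(\<lambda>k. s (z (r k)) * (2 * (g (z (Suc (r k))) - g (z (r k))))) \<longlonglongrightarrow> 0"
    by simp
  have "(\<lambda>k. (norm (?e (r k)))\<^sup>2) \<longlonglongrightarrow> 0"
    by (rule tendsto_sandwich[OF _ _ tendsto_const lim0]) (use bound in auto)
  moreover have "(\<lambda>k. (norm (?e (r k)))\<^sup>2) \<longlonglongrightarrow> (norm (W x + b - s x *\<^sub>R x))\<^sup>2"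
    using r(2) by (intro tendsto_intros W_tendsto s_tendsto) (auto simp: o_def)
  ultimately have "(norm (W x + b - s x *\<^sub>R x))\<^sup>2 = 0"
    using LIMSEQ_unique by blast
  then show ?thesis by simp
qed

text \<open>On the sphere the linear Taylor term is a squared chord length, so optimality compares
  \<open>s x\<close> with the curvature of \<open>W\<close> along the chord.\<close>

lemma g_gap:
  assumes "W x + b = s x *\<^sub>R x" "norm x = 1" "norm y = 1"
  shows "g x - g y = (s x * ((y - x) \<bullet> (y - x)) - (y - x) \<bullet> W (y - x)) / 2"
proof -
  have "g y = g x + s x * (x \<bullet> (y - x)) + ((y - x) \<bullet> W (y - x)) / 2"
    using g_expand[of y x] assms(1) by simp
  then show ?thesis unfolding inner_diff_unit[OF assms(2,3)] by (simp add: field_simps)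
qed

lemma eigen_component:
  assumes "W d = \<omega> *\<^sub>R d" "d \<bullet> b = 0"
  shows "s (z k) * (d \<bullet> z (Suc k)) = \<omega> * (d \<bullet> z k)"
  using arg_cong[OF step'[of k], of "inner d"] assms sym[of d "z k"]
  by (simp add: inner_add_right)

lemma generic_nonzero: "\<omega> \<noteq> 0 \<Longrightarrow> v \<bullet> z k \<noteq> 0"
proof (induction k)
  case (Suc k)
  then show ?case using eigen_component[OF eig orth, of k] by auto
qed (simp add: generic)

lemma top_nonneg: "0 \<le> \<omega>"
  using psd[of "z 0"] top[of "z 0"] by (simp add: inner_z_self)

text \<open>Either \<open>\<omega> \<le> s (z k)\<close> infinitely often and this passes to a
  limit, or the component along \<open>v\<close> eventually grows in modulus; being bounded, it
  forces \<open>s (z k)\<close> to tend to \<open>\<omega>\<close>.\<close>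

lemma good_cluster:
  obtains r x where "strict_mono r" "(z \<circ> r) \<longlonglongrightarrow> x" "\<omega> \<le> s x"
proof (cases "infinite {k. \<omega> \<le> s (z k)}")
  case True
  then obtain r :: "nat \<Rightarrow> nat" where r: "strict_mono r" "\<And>k. \<omega> \<le> s (z (r k))"
    using infinite_enumerate by blast
  obtain x r' where x: "strict_mono r'" "(z \<circ> (r \<circ> r')) \<longlonglongrightarrow> x"
    using subseq_cluster[OF r(1)] by blast
  have "\<omega> \<le> s x"
    using s_tendsto[OF x(2)] r(2) by (intro LIMSEQ_le_const) (auto simp: o_def)
  with that x r(1) show ?thesis using strict_mono_o by blast
next
  case False
  define t where "t k = \<bar>v \<bullet> z k\<bar>" for k
  have ev: "\<forall>\<^sub>F k in sequentially. s (z k) < \<omega>"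
    using False by (simp add: eventually_cofinite not_less flip: cofinite_eq_sequentially)
  then obtain N where N: "\<And>k. k \<ge> N \<Longrightarrow> s (z k) < \<omega>"
    by (auto simp: eventually_sequentially)
  \<comment> \<open>Positivity of \<open>\<omega>\<close> keeps every \<open>v \<bullet> z k\<close>
    nonzero.\<close>
  have \<omega>: "\<omega> > 0" using N[of N] s_nonneg[of "z N"] by simp
  have t_step: "s (z k) * t (Suc k) = \<omega> * t k" for k
    using eigen_component[OF eig orth, of k] s_nonneg[of "z k"] \<omega>
    by (metis abs_mult abs_of_nonneg less_imp_le t_def)
  have t_pos: "t k > 0" for k using generic_nonzero[of k] \<omega> by (simp add: t_def)
  have "t k \<le> t (Suc k)" if "k \<ge> N" for k
  proof -
    have "\<omega> * t k \<le> \<omega> * t (Suc k)"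
      using N[OF that] t_pos[of "Suc k"] by (subst t_step[symmetric]) simp
    then show ?thesis using \<omega> by simp
  qed
  then have inc: "incseq (\<lambda>k. t (k + N))" by (intro incseq_SucI) simp
  have "t k \<le> norm v" for k
    using Cauchy_Schwarz_ineq2[of v "z k"] by (simp add: t_def norm_z)
  then obtain l where l: "(\<lambda>k. t (k + N)) \<longlonglongrightarrow> l" "\<And>k. t (k + N) \<le> l"
    using incseq_convergent[OF inc] by metis
  have "l > 0" using l(2)[of 0] t_pos[of N] by simp
  have "t \<longlonglongrightarrow> l" using l(1) by (rule LIMSEQ_offset)
  \<comment> \<open>As \<open>l\<close> is nonzero, ratios of successive \<open>t\<close> tend to
    1.\<close>
  then have "(\<lambda>k. \<omega> * t k / t (Suc k)) \<longlonglongrightarrow> \<omega> * l / l"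
    using \<open>l > 0\<close> by (intro tendsto_intros LIMSEQ_Suc) auto
  also have "(\<lambda>k. \<omega> * t k / t (Suc k)) = (\<lambda>k. s (z k))"
  proof
    fix k
    show "\<omega> * t k / t (Suc k) = s (z k)"
      using t_step[of k] t_pos[of "Suc k"] by (simp add: field_simps)
  qed
  finally have s_lim: "(\<lambda>k. s (z k)) \<longlonglongrightarrow> \<omega>" using \<open>l > 0\<close> by simp
  obtain x r where x: "strict_mono r" "(z \<circ> r) \<longlonglongrightarrow> x"
    using subseq_cluster[OF strict_mono_id] unfolding id_o by blast
  have "s x = \<omega>"
    using s_tendsto[OF x(2)] LIMSEQ_subseq_LIMSEQ[OF s_lim x(1)]
    by (intro LIMSEQ_unique[of "\<lambda>k. s (z (r k))"]) (simp_all add: o_def)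
  with that x show ?thesis by simp
qed

lemma stationary_max:
  assumes "W x + b = s x *\<^sub>R x" "norm x = 1" "\<omega> \<le> s x" "norm y = 1"
  shows "g y \<le> g x"
proof -
  have "(y - x) \<bullet> W (y - x) \<le> s x * ((y - x) \<bullet> (y - x))"
    using top[of "y - x"] mult_right_mono[OF assms(3), of "(y - x) \<bullet> (y - x)"] by simp
  then show ?thesis using g_gap[OF assms(1,2,4)] by simp
qed

text \<open>A step scales this component by \<open>\<omega> / s (z k)\<close>; if
  \<open>s (z k) = 0\<close> the recursion says nothing and \<open>stop\<close> takes over.\<close>

lemma inner_nonneg_preserved:
  assumes "W d = \<omega> *\<^sub>R d" "d \<bullet> b = 0" "0 \<le> d \<bullet> z 0"
  shows "0 \<le> d \<bullet> z k"
proof (induction k)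
  case (Suc k)
  show ?case
  proof (cases "s (z k) = 0")
    case True
    then show ?thesis using Suc stop[of k] by (simp add: s_def)
  next
    case False
    then have "0 < s (z k)" using s_nonneg[of "z k"] by simp
    moreover have "0 \<le> s (z k) * (d \<bullet> z (Suc k))"
      using eigen_component[OF assms(1,2)] Suc top_nonneg by simp
    ultimately show ?thesis by (simp add: zero_le_mult_iff)
  qed
qed (fact assms(3))

lemma converges_to_max:
  obtains x where "norm x = 1" "\<And>y. norm y = 1 \<Longrightarrow> g y \<le> g x" "z \<longlonglongrightarrow> x"
proof -
  obtain r x where x: "strict_mono r" "(z \<circ> r) \<longlonglongrightarrow> x" "\<omega> \<le> s x"
    using good_cluster by blast
  note st = cluster_stationary[OF x(1,2)]
  note nx = cluster_norm[OF x(2)]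
  have max: "g y \<le> g x" if "norm y = 1" for y
    using stationary_max st nx x(3) that by blast
  have unique: "y = x" if y: "strict_mono r'" "(z \<circ> r') \<longlonglongrightarrow> y" for r' y
  proof (rule ccontr)
    assume "y \<noteq> x"
    define d where "d = y - x"
    have ny: "norm y = 1" using cluster_norm[OF y(2)] .
    have dpos: "d \<bullet> d > 0" using \<open>y \<noteq> x\<close> by (simp add: d_def)
    have "g x = g y" using g_tendsto_cluster[OF x(1,2)] g_tendsto_cluster[OF y] LIMSEQ_unique by blast
    then have zero: "s x * (d \<bullet> d) = d \<bullet> W d" using g_gap[OF st nx ny] by (simp add: d_def)
    then have "s x * (d \<bullet> d) \<le> \<omega> * (d \<bullet> d)" using top[of d] by simp
    then have sx: "s x = \<omega>" using dpos x(3) by simp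
    \<comment> \<open>\<open>d\<close> attains the bound in \<open>top\<close>, so this semidefinite
      form vanishes at \<open>d\<close>.\<close>
    define Q where "Q u = \<omega> *\<^sub>R u - W u" for u
    have "Q d = 0"
    proof (rule psd_form_eq_0_imp_kernel[of Q])
      show "linear Q" unfolding Q_def[abs_def]
        by (intro linear_compose_sub lin linear_scaleR)
      show "u \<bullet> Q w = Q u \<bullet> w" for u w
        using sym[of u w] by (simp add: Q_def inner_diff_left inner_diff_right)
      show "0 \<le> u \<bullet> Q u" for u using top[of u] by (simp add: Q_def inner_diff_right)
      show "d \<bullet> Q d = 0" using zero sx by (simp add: Q_def inner_diff_right)
    qed
    then have eig_d: "W d = \<omega> *\<^sub>R d" by (simp add: Q_def)
    \<comment> \<open>Pairing stationarity of \<open>x\<close> with \<open>d\<close> cancels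
      \<open>\<omega> * (d \<bullet> x)\<close>.\<close>
    have orth_d: "d \<bullet> b = 0"
      using arg_cong[OF st, of "inner d"] sx eig_d sym[of d x] by (simp add: inner_add_right)
    \<comment> \<open>The hyperplane orthogonal to \<open>d\<close> strictly separates the unit
      vectors \<open>x\<close> and \<open>y\<close>.\<close>
    have dx: "d \<bullet> x = - (d \<bullet> d) / 2"
      using inner_diff_unit[OF nx ny] by (simp add: d_def inner_commute)
    then have dy: "d \<bullet> y = (d \<bullet> d) / 2"
      by (simp add: d_def inner_diff_right)
    have limx: "(\<lambda>k. d \<bullet> z (r k)) \<longlonglongrightarrow> d \<bullet> x" and limy: "(\<lambda>k. d \<bullet> z (r' k)) \<longlonglongrightarrow> d \<bullet> y"
      using x(2) y(2) by (auto intro!: tendsto_intros simp: o_def)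
    show False
    proof (cases "0 \<le> d \<bullet> z 0")
      case True
      then have "0 \<le> d \<bullet> x"
        using inner_nonneg_preserved[OF eig_d orth_d] by (intro LIMSEQ_le_const[OF limx]) auto
      then show False using dx dpos by simp
    next
      case False
      have "0 \<le> - d \<bullet> z k" for k
        using inner_nonneg_preserved[of "- d" k] eig_d orth_d False by (simp add: linear_neg[OF lin])
      then have "d \<bullet> y \<le> 0" by (intro LIMSEQ_le_const2[OF limy]) auto
      then show False using dy dpos by simp
    qed
  qed
  have "z \<longlonglongrightarrow> x"
    by (rule compact_unique_cluster_imp_tendsto[of "sphere 0 1"]) (use unique in \<open>auto simp: norm_z\<close>)
  then show thesis using that nx max by blast
qed

end

section \<open>The smallest eigenvalue of a symmetric operator\<close>

text \<open>\<open>u\<close> minimizes the Rayleigh quotient, so the form of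
  \<open>T - \<mu> I\<close> is semidefinite and vanishes at \<open>u\<close>.\<close>

lemma symmetric_min_eigenvector:
  fixes T :: "'a::euclidean_space \<Rightarrow> 'a"
  assumes lin: "linear T" and sym: "\<And>x y. x \<bullet> T y = T x \<bullet> y"
  obtains u \<mu> where "norm u = 1" "T u = \<mu> *\<^sub>R u" "\<And>x. \<mu> * (x \<bullet> x) \<le> x \<bullet> T x"
proof -
  have "continuous_on (sphere 0 1) (\<lambda>x. x \<bullet> T x)"
    using lin by (intro continuous_intros linear_continuous_on) (simp add: linear_linear)
  moreover have "sphere (0::'a) 1 \<noteq> {}" by simp
  ultimately obtain u where u: "norm u = 1" "\<And>y. norm y = 1 \<Longrightarrow> u \<bullet> T u \<le> y \<bullet> T y"
    using continuous_attains_inf[of "sphere (0::'a) 1" "\<lambda>x. x \<bullet> T x"] by auto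
  define \<mu> where "\<mu> = u \<bullet> T u"
  have min: "\<mu> * (x \<bullet> x) \<le> x \<bullet> T x" for x
  proof (cases "x = 0")
    case False
    then have "\<mu> \<le> sgn x \<bullet> T (sgn x)" using u(2)[of "sgn x"] by (simp add: \<mu>_def norm_sgn)
    also have "\<dots> = (x \<bullet> T x) / (x \<bullet> x)"
      by (simp add: sgn_div_norm linear_scale[OF lin] divide_inverse power2_eq_square
          flip: power2_norm_eq_inner)
    finally show ?thesis using False by (simp add: pos_le_divide_eq)
  qed (simp add: linear_0[OF lin])
  define Q where "Q x = T x - \<mu> *\<^sub>R x" for x
  have "Q u = 0"
  proof (rule psd_form_eq_0_imp_kernel[of Q])
    show "linear Q" unfolding Q_def[abs_def] by (intro linear_compose_sub lin linear_scaleR)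
    show "x \<bullet> Q y = Q x \<bullet> y" for x y
      using sym[of x y] by (simp add: Q_def inner_diff_left inner_diff_right)
    show "0 \<le> x \<bullet> Q x" for x using min[of x] by (simp add: Q_def inner_diff_right)
    show "u \<bullet> Q u = 0" using u(1) by (simp add: Q_def inner_diff_right \<mu>_def norm_eq_1)
  qed
  then show thesis using that[of u \<mu>] u(1) min by (simp add: Q_def)
qed

section \<open>Null sets on the sphere\<close>

text \<open>The cone over the exceptional set lies in a Lebesgue-null hyperplane.\<close>

lemma AE_uniform_sphere_inner_nonzero:
  fixes v :: "'a::euclidean_space"
  assumes "v \<noteq> 0"
  shows "AE x in uniform_sphere. v \<bullet> x \<noteq> 0"
proof -
  let ?\<sigma> = "sphere_surface_measure :: 'a measure"
  let ?E = "{x \<in> sphere 0 1. v \<bullet> x = 0}"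
  let ?C = "{r *\<^sub>R x |r x. 0 < r \<and> r \<le> 1 \<and> x \<in> ?E}"
  have "?E = sphere 0 1 \<inter> {x. v \<bullet> x = 0}" by auto
  then have E: "?E \<in> sets borel" using closed_hyperplane[of v 0] by (simp add: borel_closed)
  have "negligible {x. v \<bullet> x = 0}" using assms by (simp add: negligible_hyperplane)
  then have "{x. v \<bullet> x = 0} \<in> null_sets lebesgue" by (simp add: negligible_iff_null_sets)
  then have "emeasure lborel {x. v \<bullet> x = 0} = 0"
    using closed_hyperplane[of v 0] by (simp add: null_sets_def borel_closed)
  moreover have "emeasure lborel ?C \<le> emeasure lborel {x. v \<bullet> x = 0}"
    using closed_hyperplane[of v 0] by (intro emeasure_mono) (auto simp: borel_closed)
  ultimately have "emeasure ?\<sigma> ?E = 0"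
    using emeasure_sphere_surface_measure[of ?E] E by (simp add: subset_iff)
  moreover have "?E \<in> sets ?\<sigma>" using E by (auto simp: sets_restrict_space_iff)
  ultimately have "AE x in ?\<sigma>. v \<bullet> x \<noteq> 0" by (intro AE_I[of _ _ ?E]) auto
  moreover have "sphere 0 1 \<in> sets ?\<sigma>" by (simp add: sets_restrict_space_iff)
  ultimately show ?thesis
    unfolding uniform_sphere_def
    using emeasure_sphere_surface_measure_sphere
    by (subst AE_uniform_measure) (auto simp: less_top)
qed

section \<open>Block structure, spectral bounds and the step map\<close>

definition lower :: "real ^ ('n + 'n) \<Rightarrow> real ^ 'n" where
  "lower z = (\<chi> i. z $ Inr i)"

definition upper :: "real ^ ('n + 'n) \<Rightarrow> real ^ 'n" where
  "upper z = (\<chi> i. z $ Inl i)"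

lemma sum_UNIV_sum:
  fixes h :: "'a::finite + 'b::finite \<Rightarrow> 'c::comm_monoid_add"
  shows "sum h UNIV = (\<Sum>i\<in>UNIV. h (Inl i)) + (\<Sum>i\<in>UNIV. h (Inr i))"
  by (simp add: sum.Plus flip: UNIV_Plus_UNIV)

lemma inner_blocks: "x \<bullet> y = upper x \<bullet> upper y + lower x \<bullet> lower y"
  by (simp add: inner_vec_def sum_UNIV_sum upper_def lower_def)

lemma blocks_block_diag2:
  "upper (block_diag2 H *v z) = H *v upper z" "lower (block_diag2 H *v z) = H *v lower z"
  by (simp_all add: vec_eq_iff matrix_vector_mult_def sum_UNIV_sum upper_def lower_def block_diag2_def)

lemma inner_block_diag2:
  "x \<bullet> (block_diag2 H *v y) = upper x \<bullet> (H *v upper y) + lower x \<bullet> (H *v lower y)"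
  by (simp add: inner_blocks[of x] blocks_block_diag2)

lemma inner_matrix_symmetric:
  fixes H :: "real ^ 'n ^ 'n"
  assumes "transpose H = H"
  shows "x \<bullet> (H *v y) = (H *v x) \<bullet> y"
  using assms dot_lmul_matrix[of x H y] by (metis vector_transpose_matrix)

lemma inner_matrix_le_onorm:
  fixes H :: "real ^ 'n ^ 'n"
  shows "x \<bullet> (H *v x) \<le> onorm ((*v) H) * (x \<bullet> x)"
proof -
  have "x \<bullet> (H *v x) \<le> norm x * norm (H *v x)" by (rule norm_cauchy_schwarz)
  also have "\<dots> \<le> norm x * (onorm ((*v) H) * norm x)"
    by (intro mult_left_mono onorm matrix_vector_mul_bounded_linear) simp
  finally show ?thesis by (simp add: dot_square_norm power2_eq_square mult_ac)
qed

text \<open>Multiplying by the norm absorbs the case distinction: both sides vanish for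
  \<open>w = 0\<close>.\<close>

lemma norm_scaleR_pg_step:
  assumes "z - \<eta> *\<^sub>R grad_quad A a z = w"
  shows "norm w *\<^sub>R pg_step A a \<eta> z = w"
  using assms by (simp add: pg_step_def)

lemma norm_pg_step: "norm z = 1 \<Longrightarrow> norm (pg_step A a \<eta> z) = 1"
  by (simp add: pg_step_def Let_def)

lemma pg_step_stop: "z - \<eta> *\<^sub>R grad_quad A a z = 0 \<Longrightarrow> pg_step A a \<eta> z = z"
  by (simp add: pg_step_def)

section \<open>Reduction of the quadratic program to the affine iteration\<close>

text \<open>The disjunction reads \<open>1 / L\<close> as infinite when \<open>H = 0\<close>; the
  HOL value \<open>1 / 0 = 0\<close> would exclude that case.\<close>

theorem theorem4p3:
  fixes H :: "real ^ 'n ^ 'n" and c :: "real ^ 'n"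
    and A :: "real ^ ('n + 'n) ^ ('n + 'n)" and a :: "real ^ ('n + 'n)"
    and L \<eta> :: real
  assumes "transpose H = H"
    and "A = block_diag2 H" and "a = pad_zero c"
    and "L = onorm ((*v) H)"
    and "0 < \<eta>" and "L = 0 \<or> \<eta> \<le> 1 / L"
  shows "AE z0 in uniform_sphere.
           \<exists>z. is_arg_min (quad A a) (\<lambda>x. x \<in> sphere 0 1) z \<and>
               pg_iter A a \<eta> z0 \<longlonglongrightarrow> z"
proof -
  have symH: "x \<bullet> (H *v y) = (H *v x) \<bullet> y" for x y
    using assms(1) by (rule inner_matrix_symmetric)
  obtain u \<mu> where u: "norm u = 1" "H *v u = \<mu> *\<^sub>R u" "\<And>x. \<mu> * (x \<bullet> x) \<le> x \<bullet> (H *v x)"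
    using symmetric_min_eigenvector[of "(*v) H"] symH by auto
  define v :: "real ^ ('n + 'n)" where "v = (\<chi> i. case i of Inl _ \<Rightarrow> 0 | Inr p \<Rightarrow> u $ p)"
  define W where "W z = z - \<eta> *\<^sub>R (A *v z)" for z
  define b where "b = - \<eta> *\<^sub>R a"
  have v: "upper v = 0" "lower v = u" by (simp_all add: v_def upper_def lower_def vec_eq_iff)
  have a: "lower a = 0" by (simp add: assms(3) pad_zero_def lower_def vec_eq_iff)
  have Av: "A *v v = \<mu> *\<^sub>R v"
  proof -
    have "(A *v v) $ i = (\<mu> *\<^sub>R v) $ i" for i
    proof (cases i)
      case (Inl p)
      have "upper (A *v v) = 0" by (simp add: assms(2) blocks_block_diag2 v)
      then show ?thesis using Inl by (simp add: v_def upper_def vec_eq_iff)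
    next
      case (Inr p)
      have "lower (A *v v) = \<mu> *\<^sub>R u" by (simp add: assms(2) blocks_block_diag2 v u(2))
      then show ?thesis using Inr by (simp add: v_def lower_def vec_eq_iff)
    qed
    then show ?thesis by (simp add: vec_eq_iff)
  qed
  have symA: "x \<bullet> (A *v y) = (A *v x) \<bullet> y" for x y
    using symH by (simp add: assms(2) inner_block_diag2 inner_blocks[of "_ *v _"] blocks_block_diag2)
  \<comment> \<open>The step size bound makes \<open>W\<close> positive semidefinite.\<close>
  have upA: "\<eta> * (x \<bullet> (A *v x)) \<le> x \<bullet> x" for x
  proof -
    have "0 \<le> L" using assms(4) onorm_pos_le matrix_vector_mul_bounded_linear by blast
    then have "\<eta> * L \<le> 1" using assms(5,6) by (cases "L = 0") (simp_all add: pos_le_divide_eq less_le)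
    have "x \<bullet> (A *v x) \<le> L * (x \<bullet> x)"
      using inner_matrix_le_onorm[of "upper x" H] inner_matrix_le_onorm[of "lower x" H]
      by (simp add: assms(2,4) inner_block_diag2 inner_blocks[of x x] distrib_left)
    then have "\<eta> * (x \<bullet> (A *v x)) \<le> (\<eta> * L) * (x \<bullet> x)"
      using assms(5) by (simp add: mult.assoc)
    also have "\<dots> \<le> 1 * (x \<bullet> x)" using \<open>\<eta> * L \<le> 1\<close> by (intro mult_right_mono) auto
    finally show ?thesis by simp
  qed
  \<comment> \<open>As \<open>\<eta> > 0\<close>, the smallest eigenvalue \<open>\<mu>\<close> of
    \<open>A\<close> yields the largest one, \<open>1 - \<eta> * \<mu>\<close>, of
    \<open>W\<close>.\<close>
  have lowA: "\<eta> * (\<mu> * (x \<bullet> x)) \<le> \<eta> * (x \<bullet> (A *v x))" for x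
  proof -
    have "\<mu> * (x \<bullet> x) \<le> x \<bullet> (A *v x)"
      using u(3)[of "upper x"] u(3)[of "lower x"]
      by (simp add: assms(2) inner_block_diag2 inner_blocks[of x x] distrib_left)
    then show ?thesis using assms(5) by simp
  qed
  have Wb: "z - \<eta> *\<^sub>R grad_quad A a z = W z + b" for z
    by (simp add: W_def b_def grad_quad_def scaleR_add_right)
  have "v \<bullet> v = 1" using u(1) by (simp add: inner_blocks[of v v] v norm_eq_1)
  then have "v \<noteq> 0" by auto
  then have "AE z0 in uniform_sphere. v \<bullet> z0 \<noteq> 0" by (rule AE_uniform_sphere_inner_nonzero)
  moreover have "AE z0 in uniform_sphere. norm (z0 :: real ^ ('n + 'n)) = 1"
    by (rule AE_I2) simp
  ultimately show ?thesis
  proof eventually_elim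
    case (elim z0)
    define z where "z = pg_iter A a \<eta> z0"
    have norm_z: "norm (z k) = 1" for k
      by (induction k) (use elim(2) in \<open>simp_all add: z_def norm_pg_step\<close>)
    interpret normalized_affine_iteration W b v "1 - \<eta> * \<mu>" z
    proof
      show "W (x + y) = W x + W y" "W (r *\<^sub>R x) = r *\<^sub>R W x" for x y r
        by (simp_all add: W_def algebra_simps matrix_vector_mult_scaleR)
      show "x \<bullet> W y = W x \<bullet> y" for x y
        using symA[of x y] by (simp add: W_def inner_diff_left inner_diff_right)
      show "0 \<le> x \<bullet> W x" "x \<bullet> W x \<le> (1 - \<eta> * \<mu>) * (x \<bullet> x)" for x
        using upA[of x] lowA[of x] by (simp_all add: W_def inner_diff_right algebra_simps)
      show "W v = (1 - \<eta> * \<mu>) *\<^sub>R v" by (simp add: W_def Av algebra_simps)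
      show "v \<bullet> b = 0" by (simp add: b_def inner_blocks[of v a] v a)
      show "norm (z k) = 1" for k by (fact norm_z)
      show "norm (W (z k) + b) *\<^sub>R z (Suc k) = W (z k) + b" for k
        using norm_scaleR_pg_step[OF Wb] by (simp add: z_def)
      show "z (Suc k) = z k" if "W (z k) + b = 0" for k
        using pg_step_stop[of "z k" \<eta> A a] that by (simp add: Wb z_def)
      show "v \<bullet> z 0 \<noteq> 0" using elim(1) by (simp add: z_def)
    qed
    obtain x where x: "norm x = 1" "\<And>y. norm y = 1 \<Longrightarrow> g y \<le> g x" "z \<longlonglongrightarrow> x"
      using converges_to_max by blast
    \<comment> \<open>On the sphere the identity part of \<open>W\<close> contributes only the
      constant \<open>1 / 2\<close>, so maximizing \<open>g\<close> minimizes the objective.\<close>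
    have g_quad: "g y = 1 / 2 - \<eta> * quad A a y" if "norm y = 1" for y
      using that unfolding g_def unfolding W_def b_def
      by (simp add: quad_def norm_eq_1 inner_diff_right field_simps)
    have "quad A a x \<le> quad A a y" if "norm y = 1" for y
      using x(2)[OF that] assms(5) by (simp add: g_quad that x(1))
    then have "is_arg_min (quad A a) (\<lambda>x. x \<in> sphere 0 1) x"
      using x(1) by (auto simp: is_arg_min_def not_less)
    with x(3) show ?case unfolding z_def by blast
  qed
qed

end
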